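(* Let $H$ be a Hilbert space and let $A$ be an unbounded self-adjoint operator in $H$ with partition of unity $E_t$, $t\in\mathbb{R}$. Let $\varphi,\psi:\mathbb{R}\to\mathbb{C}$ be continuous functions such that $|\varphi|$ and $|\psi|$ are even and strictly increasing on $(0,\infty)$, and suppose that $|\varphi(t)|^2=F(|\psi(t)|^2)$, where $F$ is a strictly increasing, concave function with $F(0)=0$. Let $W^\psi=\{x\in D(\psi(A)):\|\psi(A)x\|\le 1\}$ and let $$\omega(\delta)=\sup\{\|\varphi(A)x\|: x\in W^\psi,\ \|x\|\le\delta\}$$ be the modulus of continuity of the operator $\varphi(A)$ on the class $W^\psi$. Then for any $\delta>0$ $$\omega(\delta)\le\delta\sqrt{F\left(\frac1{\delta^2}\right)}.$$ If, in addition, $A$ is such that $(E_t-E_s)D(\psi(A))\neq\{\theta\}$ for all $0\le s<t\le\infty$, then for any $\delta>0$ $$\omega(\delta)=\delta\sqrt{F\left(\frac1{\delta^2}\right)}.$$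
   Context: $\theta$ denotes the zero element of $H$. The partition of unity (spectral family) $E_t$ of $A$ is the family of projections with $E_uE_v=E_{\min\{u,v\}}$, strongly left-continuous ($E_{t-0}=E_t$), $E_{-\infty}=0$, $E_{\infty}=I$ (strong limits), and $A=\int_{-\infty}^{+\infty}t\,dE_t$. For a function $f$ on $\mathbb{R}$ (measurable and finite almost everywhere with respect to $E_t$), $D(f(A))=\{x\in H:\int_{-\infty}^{+\infty}|f(t)|^2\,d(E_tx,x)<\infty\}$ and $f(A)x=\int_{-\infty}^{+\infty}f(t)\,dE_tx$ for $x\in D(f(A))$.
   Formalization: The equality is proved only for δ>0 such that 1/δ² is a value of |ψ|²; for all δ it is false, e.g. A = multiplication by t on L²(ℝ), ψ=1+|t|, φ=√(1+|t|), F(u)=√u, δ=2, where ω(2)≤1<√2. *)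

theory Defs
  imports "HOL-Analysis.Analysis"
begin

section \<open>Complex Hilbert spaces\<close>

text \<open>
  The norm and the topology are the inherited real ones; the axiom on the norm ties them to the
  inner product and makes the latter positive definite. The inner product is linear in the first
  argument.
\<close>

class complex_inner = real_normed_vector +
  fixes scaleC :: "complex \<Rightarrow> 'a \<Rightarrow> 'a"  (infixr \<open>*\<^sub>C\<close> 75)
    and cinner :: "'a \<Rightarrow> 'a \<Rightarrow> complex"
  assumes scaleC_add_right: "c *\<^sub>C (x + y) = c *\<^sub>C x + c *\<^sub>C y"
    and scaleC_add_left: "(c + d) *\<^sub>C x = c *\<^sub>C x + d *\<^sub>C x"
    and scaleC_scaleC: "c *\<^sub>C d *\<^sub>C x = (c * d) *\<^sub>C x"
    and scaleC_of_real: "complex_of_real r *\<^sub>C x = r *\<^sub>R x"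
    and cinner_commute: "cinner x y = cnj (cinner y x)"
    and cinner_add_left: "cinner (x + y) z = cinner x z + cinner y z"
    and cinner_scaleC_left: "cinner (c *\<^sub>C x) y = c * cinner x y"
    and norm_eq_sqrt_cinner: "norm x = sqrt (Re (cinner x x))"

class complex_hilbert = complex_inner + banach

instantiation complex :: complex_hilbert
begin

definition scaleC_complex :: "complex \<Rightarrow> complex \<Rightarrow> complex"
  where "scaleC_complex c x = c * x"

definition cinner_complex :: "complex \<Rightarrow> complex \<Rightarrow> complex"
  where "cinner_complex x y = x * cnj y"

instance
  by standard
    (simp_all add: scaleC_complex_def cinner_complex_def algebra_simps scaleR_conv_of_real
      cmod_def power2_eq_square)

end

section \<open>Operators with a domain\<close>

text \<open>
  An operator in \<open>H\<close> is given by its domain \<open>D\<close> and a function \<open>A\<close> of which only the values on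
  \<open>D\<close> matter.
\<close>

definition linear_operator :: "'h::complex_inner set \<Rightarrow> ('h \<Rightarrow> 'h) \<Rightarrow> bool"
  where "linear_operator D A \<longleftrightarrow>
    0 \<in> D \<and>
    (\<forall>x\<in>D. \<forall>y\<in>D. x + y \<in> D \<and> A (x + y) = A x + A y) \<and>
    (\<forall>c. \<forall>x\<in>D. c *\<^sub>C x \<in> D \<and> A (c *\<^sub>C x) = c *\<^sub>C A x)"

definition adjoint_dom :: "'h::complex_inner set \<Rightarrow> ('h \<Rightarrow> 'h) \<Rightarrow> 'h set"
  where "adjoint_dom D A = {y. \<exists>z. \<forall>x\<in>D. cinner (A x) y = cinner x z}"

definition adjoint_op :: "'h::complex_inner set \<Rightarrow> ('h \<Rightarrow> 'h) \<Rightarrow> 'h \<Rightarrow> 'h"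
  where "adjoint_op D A y = (THE z. \<forall>x\<in>D. cinner (A x) y = cinner x z)"

definition self_adjoint_operator :: "'h::complex_inner set \<Rightarrow> ('h \<Rightarrow> 'h) \<Rightarrow> bool"
  where "self_adjoint_operator D A \<longleftrightarrow>
    linear_operator D A \<and> closure D = UNIV \<and>
    adjoint_dom D A = D \<and> (\<forall>y\<in>D. adjoint_op D A y = A y)"

definition unbounded_operator :: "'h::complex_inner set \<Rightarrow> ('h \<Rightarrow> 'h) \<Rightarrow> bool"
  where "unbounded_operator D A \<longleftrightarrow> \<not> (\<exists>K. \<forall>x\<in>D. norm (A x) \<le> K * norm x)"

section \<open>Spectral families\<close>

definition orthogonal_projection :: "('h::complex_inner \<Rightarrow> 'h) \<Rightarrow> bool"
  where "orthogonal_projection P \<longleftrightarrow>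
    linear_operator UNIV P \<and> (\<forall>x. P (P x) = P x) \<and> (\<forall>x y. cinner (P x) y = cinner x (P y))"

definition spectral_family :: "(real \<Rightarrow> 'h::complex_inner \<Rightarrow> 'h) \<Rightarrow> bool"
  where "spectral_family E \<longleftrightarrow>
    (\<forall>t. orthogonal_projection (E t)) \<and>
    (\<forall>u v x. E u (E v x) = E (min u v) x) \<and>
    (\<forall>t x. ((\<lambda>s. E s x) \<longlongrightarrow> E t x) (at_left t)) \<and>
    (\<forall>x. ((\<lambda>t. E t x) \<longlongrightarrow> 0) at_bot) \<and>
    (\<forall>x. ((\<lambda>t. E t x) \<longlongrightarrow> x) at_top)"

definition spectral_extend :: "(real \<Rightarrow> 'h::complex_inner \<Rightarrow> 'h) \<Rightarrow> ereal \<Rightarrow> 'h \<Rightarrow> 'h"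
  where "spectral_extend E t x = (case t of ereal r \<Rightarrow> E r x | PInfty \<Rightarrow> x | MInfty \<Rightarrow> 0)"

section \<open>Integration with respect to a spectral family\<close>

text \<open>
  The library's \<^const>\<open>interval_measure\<close> is for right-continuous functions; a left-continuous
  nondecreasing \<open>g\<close> is reduced to it by the reflection \<open>t \<mapsto> - t\<close>.
\<close>

definition left_interval_measure :: "(real \<Rightarrow> real) \<Rightarrow> real measure"
  where "left_interval_measure g = distr (interval_measure (\<lambda>s. - g (- s))) borel uminus"

lemma emeasure_left_interval_measure_Ico:
  assumes "a \<le> b" "mono g" "\<And>t. (g \<longlongrightarrow> g t) (at_left t)"
  shows "emeasure (left_interval_measure g) {a..<b} = ennreal (g b - g a)"
proof -
  have vimage: "uminus -` {a..<b} = {- b<..- a}"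
    by auto
  have cont: "continuous (at_right s) (\<lambda>s. - g (- s))" for s
  proof -
    have "((\<lambda>s. g (- s)) \<longlongrightarrow> g (- s)) (at_right s)"
      using assms(3)[of "- s"] by (simp add: filterlim_at_left_to_right)
    then show ?thesis
      unfolding continuous_within by (rule tendsto_minus)
  qed
  have mono: "- g (- x) \<le> - g (- y)" if "x \<le> y" for x y
    using that \<open>mono g\<close> by (simp add: monoD)
  have "emeasure (left_interval_measure g) {a..<b}
      = emeasure (interval_measure (\<lambda>s. - g (- s))) {- b<..- a}"
    unfolding left_interval_measure_def by (subst emeasure_distr) (simp_all add: vimage)
  also have "\<dots> = ennreal (g b - g a)"
    using emeasure_interval_measure_Ioc[of "- b" "- a" "\<lambda>s. - g (- s)", OF _ mono cont] \<open>a \<le> b\<close>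
    by simp
  finally show ?thesis .
qed

text \<open>The measure \<open>d(E\<^sub>t x, x)\<close>; the number \<open>(E\<^sub>t x, x)\<close> is real.\<close>

definition spectral_measure :: "(real \<Rightarrow> 'h::complex_inner \<Rightarrow> 'h) \<Rightarrow> 'h \<Rightarrow> real measure"
  where "spectral_measure E x = left_interval_measure (\<lambda>t. Re (cinner (E t x) x))"

definition spectral_dom :: "(real \<Rightarrow> 'h::complex_inner \<Rightarrow> 'h) \<Rightarrow> (real \<Rightarrow> complex) \<Rightarrow> 'h set"
  where "spectral_dom E f =
    {x. (\<integral>\<^sup>+ t. ennreal ((cmod (f t))\<^sup>2) \<partial>spectral_measure E x) < \<infinity>}"

text \<open>
  A list of triples \<open>(c, a, b)\<close> with \<open>a \<le> b\<close> represents the step function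
  \<open>\<Sum> c \<cdot> 1\<^bsub>[a,b)\<^esub>\<close>, whose integral \<open>\<integral> g(t) dE\<^sub>t x\<close> is \<open>\<Sum> c (E\<^sub>b - E\<^sub>a) x\<close>. The vector integral of
  a measurable \<open>f\<close> is the extension of this map by the isometry
  \<open>\<parallel>\<integral> g(t) dE\<^sub>t x\<parallel>\<^sup>2 = \<integral> \<bar>g(t)\<bar>\<^sup>2 d(E\<^sub>t x, x)\<close> to all \<open>f\<close> that are square integrable with respect to
  \<open>d(E\<^sub>t x, x)\<close>.
\<close>

definition step_function :: "(complex \<times> real \<times> real) list \<Rightarrow> real \<Rightarrow> complex"
  where "step_function g t = (\<Sum>(c, a, b)\<leftarrow>g. c * indicator {a..<b} t)"

definition step_integral ::
    "(real \<Rightarrow> 'h::complex_inner \<Rightarrow> 'h) \<Rightarrow> (complex \<times> real \<times> real) list \<Rightarrow> 'h \<Rightarrow> 'h"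
  where "step_integral E g x = (\<Sum>(c, a, b)\<leftarrow>g. c *\<^sub>C (E b x - E a x))"

definition has_spectral_integral ::
    "(real \<Rightarrow> 'h::complex_inner \<Rightarrow> 'h) \<Rightarrow> (real \<Rightarrow> complex) \<Rightarrow> 'h \<Rightarrow> 'h \<Rightarrow> bool"
  where "has_spectral_integral E f x z \<longleftrightarrow>
    (\<exists>g :: nat \<Rightarrow> (complex \<times> real \<times> real) list.
      (\<forall>n. \<forall>(c, a, b)\<in>set (g n). a \<le> b) \<and>
      (\<lambda>n. \<integral>\<^sup>+ t. ennreal ((cmod (f t - step_function (g n) t))\<^sup>2) \<partial>spectral_measure E x)
        \<longlonglongrightarrow> 0 \<and>
      (\<lambda>n. step_integral E (g n) x) \<longlonglongrightarrow> z)"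

text \<open>The value \<open>f(A) x\<close> for \<open>x\<close> in \<open>D(f(A))\<close>.\<close>

definition spectral_op ::
    "(real \<Rightarrow> 'h::complex_inner \<Rightarrow> 'h) \<Rightarrow> (real \<Rightarrow> complex) \<Rightarrow> 'h \<Rightarrow> 'h"
  where "spectral_op E f x = (THE z. has_spectral_integral E f x z)"

definition partition_of_unity ::
    "'h::complex_inner set \<Rightarrow> ('h \<Rightarrow> 'h) \<Rightarrow> (real \<Rightarrow> 'h \<Rightarrow> 'h) \<Rightarrow> bool"
  where "partition_of_unity D A E \<longleftrightarrow>
    spectral_family E \<and>
    D = spectral_dom E complex_of_real \<and> (\<forall>x\<in>D. A x = spectral_op E complex_of_real x)"

section \<open>The modulus of continuity\<close>

definition spectral_class ::
    "(real \<Rightarrow> 'h::complex_inner \<Rightarrow> 'h) \<Rightarrow> (real \<Rightarrow> complex) \<Rightarrow> 'h set"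
  where "spectral_class E \<psi> = {x \<in> spectral_dom E \<psi>. norm (spectral_op E \<psi> x) \<le> 1}"

text \<open>Extended-real valued, since \<^const>\<open>Sup\<close> on \<^typ>\<open>real\<close> is unspecified for unbounded sets.\<close>

definition modulus_of_continuity ::
    "('h::complex_inner \<Rightarrow> 'h) \<Rightarrow> 'h set \<Rightarrow> real \<Rightarrow> ereal"
  where "modulus_of_continuity T W \<delta> = (SUP x\<in>{x \<in> W. norm x \<le> \<delta>}. ereal (norm (T x)))"

end

theory Submission
  imports Defs
begin

text \<open>
  Write \<open>\<mu>\<^sub>x\<close> for the measure \<open>d(E\<^sub>t x, x)\<close>, of total mass \<open>\<parallel>x\<parallel>\<^sup>2\<close>. The spectral integral is isometric:
  \<open>\<parallel>f(A) x\<parallel>\<^sup>2 = \<integral> \<bar>f\<bar>\<^sup>2 d\<mu>\<^sub>x\<close> for \<open>x\<close> in \<open>D(f(A))\<close> (\<open>norm_spectral_op\<close>). Through this identity both halves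
  of the theorem become statements about integrals of \<open>\<bar>\<phi>\<bar>\<^sup>2 = F(\<bar>\<psi>\<bar>\<^sup>2)\<close> and \<open>\<bar>\<psi>\<bar>\<^sup>2\<close> against one finite
  measure.

  For the upper bound (\<open>norm_spectral_op_le\<close>), put \<open>u = 1/\<delta>\<^sup>2\<close> and take a supporting line
  \<open>F(v) \<le> a + k v\<close> of the concave function \<open>F\<close> that touches it at \<open>u\<close>. Monotonicity of \<open>F\<close> gives
  \<open>k \<ge> 0\<close>, and \<open>F(0) = 0\<close> gives \<open>a \<ge> 0\<close>. Integrating \<open>\<bar>\<phi>\<bar>\<^sup>2 \<le> a + k \<bar>\<psi>\<bar>\<^sup>2\<close> yields
  \<open>\<parallel>\<phi>(A) x\<parallel>\<^sup>2 \<le> a \<parallel>x\<parallel>\<^sup>2 + k \<parallel>\<psi>(A) x\<parallel>\<^sup>2 \<le> a \<delta>\<^sup>2 + k = \<delta>\<^sup>2 (a + k u) = \<delta>\<^sup>2 F(u)\<close>. This is Jensen's inequality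
  for \<open>\<mu>\<^sub>x\<close> together with the monotonicity of \<open>m F(1/m)\<close> in the mass \<open>m\<close>, done in one step; it also shows that
  \<open>D(\<psi>(A))\<close> is contained in \<open>D(\<phi>(A))\<close>.

  For the lower bound (\<open>modulus_of_continuity_ge\<close>), let \<open>\<tau> \<ge> 0\<close> satisfy \<open>\<bar>\<psi>(\<tau>)\<bar> = 1/\<delta>\<close>. The inequality is
  nearly an equality when \<open>\<mu>\<^sub>x\<close> is concentrated near \<open>\<tau>\<close>, and a nonzero vector in the range of
  \<open>E\<^sub>r - E\<^sub>\<tau>\<close>, for \<open>r > \<tau>\<close>, has its measure concentrated on \<open>[\<tau>, r)\<close>. Normalised to
  length \<open>1/\<bar>\<psi>(r)\<bar>\<close> it is admissible and gives \<open>\<omega>(\<delta>) \<ge> \<bar>\<phi>(\<tau>)\<bar> / \<bar>\<psi>(r)\<bar>\<close>, whose limit for \<open>r\<close> decreasing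
  to \<open>\<tau>\<close> is \<open>\<delta> \<surd>F(1/\<delta>\<^sup>2)\<close>.
\<close>

section \<open>Algebra of the inner product\<close>

lemma cinner_add_right: "cinner x (y + z) = cinner x y + cinner x (z :: 'h::complex_inner)"
  by (metis cinner_add_left cinner_commute complex_cnj_add)

lemma cinner_scaleC_right: "cinner x (c *\<^sub>C y) = cnj c * cinner x (y :: 'h::complex_inner)"
  by (metis cinner_scaleC_left cinner_commute complex_cnj_mult)

lemma scaleC_minus_one: "(- 1) *\<^sub>C x = - (x :: 'h::complex_inner)"
  using scaleC_of_real[of "- 1" x] by simp

lemma scaleC_minus_left: "(- c) *\<^sub>C x = - (c *\<^sub>C (x :: 'h::complex_inner))"
  by (metis mult_minus1 scaleC_minus_one scaleC_scaleC)

lemma cinner_minus_left: "cinner (- x) y = - cinner x (y :: 'h::complex_inner)"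
  by (metis cinner_scaleC_left mult_minus1 scaleC_minus_one)

lemma cinner_minus_right: "cinner x (- y) = - cinner x (y :: 'h::complex_inner)"
  by (metis cinner_commute cinner_minus_left complex_cnj_minus)

lemma cinner_diff_left: "cinner (x - y) z = cinner x z - cinner y (z :: 'h::complex_inner)"
  using cinner_add_left[of x "- y" z] by (simp add: cinner_minus_left)

lemma cinner_diff_right: "cinner x (y - z) = cinner x y - cinner x (z :: 'h::complex_inner)"
  using cinner_add_right[of x y "- z"] by (simp add: cinner_minus_right)

lemma cinner_zero_left: "cinner 0 (x :: 'h::complex_inner) = 0"
  using cinner_add_left[of 0 0 x] by simp

lemma cinner_zero_right: "cinner (x :: 'h::complex_inner) 0 = 0"
  using cinner_add_right[of x 0 0] by simp

lemma cinner_self: "cinner x x = complex_of_real ((norm (x :: 'h::complex_inner))\<^sup>2)"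
proof -
  have "Im (cinner x x) = 0"
    using cinner_commute[of x x] by (simp add: complex_eq_iff)
  moreover have "Re (cinner x x) \<ge> 0"
    using norm_ge_zero[of x] by (simp add: norm_eq_sqrt_cinner)
  ultimately show ?thesis
    by (simp add: norm_eq_sqrt_cinner complex_eq_iff)
qed

section \<open>The measure of a spectral family at a vector\<close>

lemma spectral_family_projection:
  "spectral_family E \<Longrightarrow> orthogonal_projection (E t)"
  by (simp add: spectral_family_def)

lemma spectral_family_scaleC:
  "spectral_family E \<Longrightarrow> E t (c *\<^sub>C x) = c *\<^sub>C E t x"
  by (simp add: spectral_family_def orthogonal_projection_def linear_operator_def)

lemma spectral_family_diff:
  assumes "spectral_family E"
  shows "E t (x - y) = E t x - E t y"
proof -
  have add: "E t (u + v) = E t u + E t v" for u v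
    using spectral_family_projection[OF assms, of t]
    by (simp add: orthogonal_projection_def linear_operator_def)
  show ?thesis
    using add[of "x - y" y] by (simp add: algebra_simps)
qed

lemma cinner_spectral_family:
  assumes "spectral_family E"
  shows "cinner (E u x) (E v x) = complex_of_real ((norm (E (min u v) x))\<^sup>2)"
proof -
  have adj: "cinner (E t y) z = cinner y (E t z)" for t y z
    using spectral_family_projection[OF assms, of t] by (simp add: orthogonal_projection_def)
  have comp: "E s (E t y) = E (min s t) y" for s t y
    using assms by (simp add: spectral_family_def)
  have "cinner (E u x) (E v x) = cinner (E (min u v) x) x"
    using adj[of v "E u x" x] comp[of v u x] by (simp add: min.commute)
  also have "\<dots> = cinner (E (min u v) x) (E (min u v) x)"
    using adj[of "min u v" "E (min u v) x" x] comp[of "min u v" "min u v" x] by simp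
  finally show ?thesis
    by (simp add: cinner_self)
qed

lemma Re_cinner_spectral_family:
  assumes "spectral_family E"
  shows "Re (cinner (E t x) x) = (norm (E t x))\<^sup>2"
proof -
  have "cinner (E t x) x = cinner (E t (E t x)) x"
    using assms by (simp add: spectral_family_def)
  also have "\<dots> = cinner (E t x) (E t x)"
    using spectral_family_projection[OF assms, of t] by (simp add: orthogonal_projection_def)
  finally show ?thesis
    by (simp add: cinner_self)
qed

text \<open>
  The increments of a spectral family are orthogonal to what came before, so lengths obey Pythagoras.
  This makes \<open>(E\<^sub>t x, x) = \<parallel>E\<^sub>t x\<parallel>\<^sup>2\<close> nondecreasing in \<open>t\<close>.
\<close>

lemma norm_diff_spectral_family:
  assumes "spectral_family E" "s \<le> t"
  shows "(norm (E t x - E s x))\<^sup>2 = (norm (E t x))\<^sup>2 - (norm (E s x))\<^sup>2"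
proof -
  have "complex_of_real ((norm (E t x - E s x))\<^sup>2)
      = complex_of_real ((norm (E t x))\<^sup>2 - (norm (E s x))\<^sup>2)"
    unfolding cinner_self[symmetric]
    using assms(2)
    by (simp add: cinner_diff_left cinner_diff_right cinner_spectral_family[OF assms(1)])
  then show ?thesis
    by (simp only: of_real_eq_iff)
qed

lemma mono_norm_spectral_family:
  assumes "spectral_family E"
  shows "mono (\<lambda>t. (norm (E t x))\<^sup>2)"
  using norm_diff_spectral_family[OF assms]
  by (intro monoI) (metis diff_ge_0_iff_ge zero_le_power2)

lemma sets_spectral_measure [measurable_cong, simp]: "sets (spectral_measure E x) = sets borel"
  by (simp add: spectral_measure_def left_interval_measure_def)

lemma space_spectral_measure [simp]: "space (spectral_measure E x) = UNIV"
  by (simp add: spectral_measure_def left_interval_measure_def)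

lemma emeasure_spectral_measure_Ico:
  assumes "spectral_family E" "a \<le> b"
  shows "emeasure (spectral_measure E x) {a..<b} = ennreal ((norm (E b x))\<^sup>2 - (norm (E a x))\<^sup>2)"
proof -
  have "((\<lambda>s. (norm (E s x))\<^sup>2) \<longlongrightarrow> (norm (E t x))\<^sup>2) (at_left t)" for t
    using assms(1) unfolding spectral_family_def by (intro tendsto_intros) blast
  then show ?thesis
    using assms(2) mono_norm_spectral_family[OF assms(1), of x]
    by (simp add: spectral_measure_def Re_cinner_spectral_family[OF assms(1)]
        emeasure_left_interval_measure_Ico)
qed

lemma emeasure_spectral_measure_UNIV:
  assumes "spectral_family E"
  shows "emeasure (spectral_measure E x) UNIV = ennreal ((norm x)\<^sup>2)"
proof -
  let ?I = "\<lambda>n::nat. {- real n..<real n}"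
  have "(\<lambda>n. emeasure (spectral_measure E x) (?I n)) \<longlonglongrightarrow> emeasure (spectral_measure E x) (\<Union>n. ?I n)"
    by (intro Lim_emeasure_incseq) (auto simp: incseq_def)
  also have "(\<Union>n. ?I n) = UNIV"
  proof -
    have "\<exists>n. t \<in> ?I n" for t :: real
    proof -
      obtain n where "\<bar>t\<bar> < real n"
        using reals_Archimedean2 by blast
      then show ?thesis
        by (intro exI[of _ n]) auto
    qed
    then show ?thesis
      by auto
  qed
  finally have "(\<lambda>n. emeasure (spectral_measure E x) (?I n)) \<longlonglongrightarrow> emeasure (spectral_measure E x) UNIV" .
  moreover have "(\<lambda>n. emeasure (spectral_measure E x) (?I n)) \<longlonglongrightarrow> ennreal ((norm x)\<^sup>2 - (norm (0::'a))\<^sup>2)"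
  proof -
    have top: "((\<lambda>t. E t x) \<longlongrightarrow> x) at_top" and bot: "((\<lambda>t. E t x) \<longlongrightarrow> 0) at_bot"
      using assms by (simp_all add: spectral_family_def)
    have "(\<lambda>n. E (real n) x) \<longlonglongrightarrow> x"
      by (rule filterlim_compose[OF top filterlim_real_sequentially])
    moreover have "(\<lambda>n. E (- real n) x) \<longlonglongrightarrow> 0"
      by (intro filterlim_compose[OF bot] filterlim_compose[OF filterlim_uminus_at_bot_at_top]
          filterlim_real_sequentially)
    ultimately show ?thesis
      by (simp only: emeasure_spectral_measure_Ico[OF assms]) (intro tendsto_intros)
  qed
  ultimately show ?thesis
    using LIMSEQ_unique by fastforce
qed

lemma finite_measure_spectral_measure:
  "spectral_family E \<Longrightarrow> finite_measure (spectral_measure E x)"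
  by (intro finite_measureI) (simp add: emeasure_spectral_measure_UNIV)

text \<open>
  Increments over disjoint intervals are orthogonal, and in general only the common part of the two
  intervals contributes. This is the source of the isometry.
\<close>

lemma cinner_spectral_increments:
  assumes "spectral_family E" "a \<le> b" "c \<le> d"
  shows "cinner (E b x - E a x) (E d x - E c x)
    = complex_of_real (measure (spectral_measure E x) ({a..<b} \<inter> {c..<d}))"
proof -
  define g where "g t = (norm (E t x))\<^sup>2" for t
  have "mono g"
    using mono_norm_spectral_family[OF assms(1)] by (simp add: g_def[abs_def])
  have meas: "measure (spectral_measure E x) {r..<s} = g s - g r" if "r \<le> s" for r s
    using that emeasure_spectral_measure_Ico[OF assms(1) that, of x] monoD[OF \<open>mono g\<close> that]
    by (simp add: measure_def g_def)
  have "g (min b d) - g (min b c) - g (min a d) + g (min a c)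
      = measure (spectral_measure E x) {max a c..<min b d}"
  proof (cases "max a c \<le> min b d")
    case True
    then have "c \<le> b" "a \<le> d"
      by auto
    then show ?thesis
      using meas[OF True] assms(2,3) by (cases "a \<le> c"; cases "b \<le> d") simp_all
  next
    case False
    then show ?thesis
      using assms(2,3) by (auto simp: min_def max_def)
  qed
  moreover have "cinner (E b x - E a x) (E d x - E c x)
      = complex_of_real (g (min b d) - g (min b c) - g (min a d) + g (min a c))"
    by (simp add: cinner_diff_left cinner_diff_right cinner_spectral_family[OF assms(1)] g_def)
  ultimately show ?thesis
    by simp
qed

section \<open>The isometry on step functions\<close>

abbreviation proper_steps :: "(complex \<times> real \<times> real) list \<Rightarrow> bool"
  where "proper_steps g \<equiv> \<forall>(c, a, b)\<in>set g. a \<le> b"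

lemma step_function_Nil [simp]: "step_function [] t = 0"
  by (simp add: step_function_def)

lemma step_function_Cons [simp]:
  "step_function ((c, a, b) # g) t = c * indicator {a..<b} t + step_function g t"
  by (simp add: step_function_def)

lemma step_integral_Nil [simp]: "step_integral E [] x = 0"
  by (simp add: step_integral_def)

lemma step_integral_Cons [simp]:
  "step_integral E ((c, a, b) # g) x = c *\<^sub>C (E b x - E a x) + step_integral E g x"
  by (simp add: step_integral_def)

lemma borel_measurable_step_function [measurable]: "step_function g \<in> borel_measurable borel"
proof (induction g)
  case Nil
  show ?case by (simp add: step_function_def)
next
  case (Cons p g)
  obtain c a b where p: "p = (c, a, b)"
    by (cases p)
  have "(\<lambda>t. c * indicator {a..<b} t + step_function g t) \<in> borel_measurable borel"
    using Cons by measurable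
  then show ?case
    by (subst p) (simp add: step_function_def[abs_def])
qed

lemma bounded_step_function: "\<exists>B. \<forall>t. cmod (step_function g t) \<le> B"
proof (induction g)
  case Nil
  show ?case by auto
next
  case (Cons p g)
  obtain c a b where p: "p = (c, a, b)"
    by (cases p)
  from Cons obtain B where B: "\<And>t. cmod (step_function g t) \<le> B"
    by blast
  have "cmod (step_function (p # g) t) \<le> cmod c + B" for t
  proof -
    have "cmod (c * indicator {a..<b} t) \<le> cmod c"
      by (simp add: indicator_def)
    then show ?thesis
      using norm_triangle_ineq[of "c * indicator {a..<b} t" "step_function g t"] B[of t]
      by (simp add: p)
  qed
  then show ?case
    by blast
qed

lemma integrable_step_functions:
  assumes "spectral_family E"
  shows "integrable (spectral_measure E x) (\<lambda>t. step_function g t * cnj (step_function h t))"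
proof -
  interpret finite_measure "spectral_measure E x"
    by (rule finite_measure_spectral_measure[OF assms])
  obtain B C where "\<And>t. cmod (step_function g t) \<le> B" "\<And>t. cmod (step_function h t) \<le> C"
    using bounded_step_function by metis
  then have "cmod (step_function g t * cnj (step_function h t)) \<le> B * C" for t
    by (simp add: norm_mult) (meson mult_mono' norm_ge_zero)
  moreover have "(\<lambda>t. step_function g t * cnj (step_function h t))
      \<in> borel_measurable (spectral_measure E x)"
  proof -
    have "(\<lambda>t. cnj (step_function h t)) \<in> borel_measurable borel"
      by (rule measurable_compose[OF borel_measurable_step_function])
        (intro borel_measurable_continuous_onI continuous_intros)
    then show ?thesis
      by measurable
  qed
  ultimately show ?thesis
    by (intro integrable_const_bound[of _ "B * C"]) auto
qed

lemma cinner_increment_step_integral: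
  assumes "spectral_family E" "a \<le> b" "proper_steps h"
  shows "cinner (c *\<^sub>C (E b x - E a x)) (step_integral E h x)
    = (LINT t|spectral_measure E x. c * indicator {a..<b} t * cnj (step_function h t))"
  using assms(3)
proof (induction h)
  case Nil
  show ?case by (simp add: cinner_zero_right)
next
  case (Cons p h)
  obtain c' a' b' where p: "p = (c', a', b')"
    by (cases p)
  let ?M = "spectral_measure E x"
  interpret finite_measure ?M
    by (rule finite_measure_spectral_measure[OF assms(1)])
  have int: "integrable ?M (\<lambda>t. c * indicator {a..<b} t * cnj (step_function k t))" for k
    using integrable_step_functions[OF assms(1), of x "[(c, a, b)]" k] by simp
  have prod: "c * indicator {a..<b} t * cnj (step_function [p] t)
      = c * cnj c' * complex_of_real (indicator ({a..<b} \<inter> {a'..<b'}) t)" for t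
    by (simp add: p indicator_def)
  have "(LINT t|?M. c * indicator {a..<b} t * cnj (step_function (p # h) t))
      = (LINT t|?M. c * indicator {a..<b} t * cnj (step_function [p] t)
          + c * indicator {a..<b} t * cnj (step_function h t))"
    by (intro Bochner_Integration.integral_cong refl) (simp add: p algebra_simps)
  also have "\<dots> = (LINT t|?M. c * indicator {a..<b} t * cnj (step_function [p] t))
      + cinner (c *\<^sub>C (E b x - E a x)) (step_integral E h x)"
    using Cons by (subst Bochner_Integration.integral_add[OF int int]) simp
  also have "(LINT t|?M. c * indicator {a..<b} t * cnj (step_function [p] t))
      = c * cnj c' * measure ?M ({a..<b} \<inter> {a'..<b'})"
    unfolding prod by (simp add: integral_complex_of_real)
  also have "\<dots> = cinner (c *\<^sub>C (E b x - E a x)) (c' *\<^sub>C (E b' x - E a' x))"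
    using Cons.prems assms(2)
    by (simp add: p cinner_scaleC_left cinner_scaleC_right cinner_spectral_increments[OF assms(1)])
  finally show ?case
    by (simp add: p cinner_add_right)
qed

text \<open>
  By sesquilinearity the claim reduces to single intervals, where it is the formula for the inner
  product of two increments. Proving it for pairs of step functions makes the two list inductions linear and
  allows the intervals of a list to overlap.
\<close>

lemma cinner_step_integral:
  assumes "spectral_family E" "proper_steps g" "proper_steps h"
  shows "cinner (step_integral E g x) (step_integral E h x)
    = (LINT t|spectral_measure E x. step_function g t * cnj (step_function h t))"
  using assms(2)
proof (induction g)
  case Nil
  show ?case by (simp add: cinner_zero_left)
next
  case (Cons p g)
  obtain c a b where p: "p = (c, a, b)"
    by (cases p)
  let ?M = "spectral_measure E x"
  have "integrable ?M (\<lambda>t. c * indicator {a..<b} t * cnj (step_function h t))"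
    using integrable_step_functions[OF assms(1), of x "[(c, a, b)]" h] by simp
  then have "(LINT t|?M. step_function (p # g) t * cnj (step_function h t))
      = (LINT t|?M. c * indicator {a..<b} t * cnj (step_function h t))
        + (LINT t|?M. step_function g t * cnj (step_function h t))"
    using integrable_step_functions[OF assms(1), of x g h]
    by (simp add: p distrib_right)
  then show ?case
    using Cons cinner_increment_step_integral[OF assms(1) _ assms(3), of a b c x]
    by (simp add: p cinner_add_left)
qed

lemma nn_integral_step_function:
  assumes "spectral_family E" "proper_steps g"
  shows "(\<integral>\<^sup>+ t. ennreal ((cmod (step_function g t))\<^sup>2) \<partial>spectral_measure E x)
    = ennreal ((norm (step_integral E g x))\<^sup>2)"
proof -
  let ?M = "spectral_measure E x"
  have sq: "step_function g t * cnj (step_function g t)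
      = complex_of_real ((cmod (step_function g t))\<^sup>2)" for t
    by (simp only: complex_norm_square)
  have int: "integrable ?M (\<lambda>t. (cmod (step_function g t))\<^sup>2)"
    using integrable_step_functions[OF assms(1), of x g g]
    unfolding sq complex_of_real_integrable_eq .
  have "complex_of_real ((norm (step_integral E g x))\<^sup>2)
      = complex_of_real (LINT t|?M. (cmod (step_function g t))\<^sup>2)"
    using cinner_step_integral[OF assms(1,2,2), of x]
    unfolding cinner_self[of "step_integral E g x"] sq integral_complex_of_real .
  then have "(LINT t|?M. (cmod (step_function g t))\<^sup>2) = (norm (step_integral E g x))\<^sup>2"
    by (simp only: of_real_eq_iff)
  then show ?thesis
    using nn_integral_eq_integral[OF int] by simp
qed

lemma step_function_append:
  "step_function (g @ h) t = step_function g t + step_function h t"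
  by (simp add: step_function_def)

lemma step_integral_append:
  "step_integral E (g @ h) x = step_integral E g x + step_integral E h x"
  by (simp add: step_integral_def)

text \<open>
  The difference of two step functions is represented by concatenating one list with the negated
  other, so the isometry turns \<open>L\<^sup>2\<close> distances into distances of vectors.
\<close>

lemma nn_integral_step_function_diff:
  assumes "spectral_family E" "proper_steps g" "proper_steps h"
  shows "(\<integral>\<^sup>+ t. ennreal ((cmod (step_function g t - step_function h t))\<^sup>2) \<partial>spectral_measure E x)
    = ennreal ((norm (step_integral E g x - step_integral E h x))\<^sup>2)"
proof -
  define h' where "h' = map (\<lambda>(c, a, b). (- c, a, b)) h"
  have neg: "step_function h' t = - step_function h t"
    "step_integral E h' x = - step_integral E h x" for t
    unfolding h'_def by (induction h) (auto simp: scaleC_minus_left)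
  have "proper_steps (g @ h')"
    using assms(2,3) by (auto simp: h'_def)
  from nn_integral_step_function[OF assms(1) this, of x] show ?thesis
    by (simp add: step_function_append step_integral_append neg)
qed

section \<open>Approximation by step functions\<close>

text \<open>
  By continuity, one constant suffices on every short interval, and step functions on adjacent intervals
  can be concatenated since each vanishes outside its own interval; bisection then covers \<open>[a, b)\<close>.
\<close>

lemma uniform_step_approximation:
  fixes f :: "real \<Rightarrow> complex"
  assumes "continuous_on UNIV f" "a \<le> b" "0 < e"
  shows "\<exists>g. proper_steps g \<and> (\<forall>t\<in>{a..<b}. cmod (f t - step_function g t) \<le> e)
    \<and> (\<forall>t. t \<notin> {a..<b} \<longrightarrow> step_function g t = 0)"
  using assms(2)
proof (induction rule: Bolzano)
  case (trans a b c)
  from trans(1) obtain g where g: "proper_steps g"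
    "\<And>t. t \<in> {a..<b} \<Longrightarrow> cmod (f t - step_function g t) \<le> e"
    "\<And>t. t \<notin> {a..<b} \<Longrightarrow> step_function g t = 0"
    by blast
  from trans(2) obtain h where h: "proper_steps h"
    "\<And>t. t \<in> {b..<c} \<Longrightarrow> cmod (f t - step_function h t) \<le> e"
    "\<And>t. t \<notin> {b..<c} \<Longrightarrow> step_function h t = 0"
    by blast
  have "proper_steps (g @ h)"
    using g(1) h(1) by auto
  moreover have "cmod (f t - step_function (g @ h) t) \<le> e" if "t \<in> {a..<c}" for t
  proof (cases "t < b")
    case True
    then show ?thesis
      using g(2)[of t] h(3)[of t] that by (simp add: step_function_append)
  next
    case False
    then show ?thesis
      using h(2)[of t] g(3)[of t] that by (simp add: step_function_append)
  qed
  moreover have "step_function (g @ h) t = 0" if "t \<notin> {a..<c}" for t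
    using g(3)[of t] h(3)[of t] that trans(3,4) by (auto simp: step_function_append)
  ultimately show ?case
    by blast
next
  case (local x)
  have "isCont f x"
    using assms(1) by (simp add: continuous_on_eq_continuous_at)
  then obtain d where "0 < d" and d: "\<And>t. dist t x < d \<Longrightarrow> dist (f t) (f x) < e"
    using assms(3) unfolding continuous_at_eps_delta by metis
  have "proper_steps [(f x, r, s)] \<and> (\<forall>t\<in>{r..<s}. cmod (f t - step_function [(f x, r, s)] t) \<le> e)
    \<and> (\<forall>t. t \<notin> {r..<s} \<longrightarrow> step_function [(f x, r, s)] t = 0)"
    if "r \<le> x" "x \<le> s" "s - r < d" for r s
  proof -
    have "cmod (f t - f x) \<le> e" if "t \<in> {r..<s}" for t
    proof -
      have "dist t x < d"
        using that \<open>r \<le> x\<close> \<open>x \<le> s\<close> \<open>s - r < d\<close> by (auto simp: dist_real_def)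
      then show ?thesis
        using d[of t] by (simp add: dist_norm)
    qed
    then show ?thesis
      using that by auto
  qed
  then show ?case
    using \<open>0 < d\<close> by blast
qed

text \<open>
  Approximate \<open>f\<close> to within \<open>1/(n+1)\<close> on \<open>[-n, n)\<close> and by zero elsewhere. The squared error is dominated by the
  integrable function \<open>1 + \<bar>f\<bar>\<^sup>2\<close>, because the measure is finite, and tends to zero pointwise.
\<close>

lemma L2_step_approximation:
  fixes f :: "real \<Rightarrow> complex"
  assumes "spectral_family E" "continuous_on UNIV f" "x \<in> spectral_dom E f"
  shows "\<exists>g. (\<forall>n. proper_steps (g n)) \<and>
    (\<lambda>n. \<integral>\<^sup>+ t. ennreal ((cmod (f t - step_function (g n) t))\<^sup>2) \<partial>spectral_measure E x)
      \<longlonglongrightarrow> 0"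
proof -
  let ?M = "spectral_measure E x"
  have [measurable]: "f \<in> borel_measurable borel"
    by (rule borel_measurable_continuous_onI[OF assms(2)])
  have "\<exists>g. proper_steps g
      \<and> (\<forall>t\<in>{- real n..<real n}. cmod (f t - step_function g t) \<le> inverse (real (Suc n)))
      \<and> (\<forall>t. t \<notin> {- real n..<real n} \<longrightarrow> step_function g t = 0)" for n
    by (intro uniform_step_approximation[OF assms(2)]) auto
  then obtain g where proper: "\<And>n. proper_steps (g n)"
    and near: "\<And>n t. t \<in> {- real n..<real n} \<Longrightarrow>
      cmod (f t - step_function (g n) t) \<le> inverse (real (Suc n))"
    and far: "\<And>n t. t \<notin> {- real n..<real n} \<Longrightarrow> step_function (g n) t = 0"
    by metis
  have dominated: "(cmod (f t - step_function (g n) t))\<^sup>2 \<le> 1 + (cmod (f t))\<^sup>2" for n t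
  proof (cases "t \<in> {- real n..<real n}")
    case True
    have "inverse (real (Suc n)) \<le> 1"
      by (simp add: field_simps)
    then have "(cmod (f t - step_function (g n) t))\<^sup>2 \<le> 1"
      using near[OF True] by (intro power_le_one) auto
    then show ?thesis
      by (simp add: add_increasing2)
  next
    case False
    then show ?thesis
      by (simp add: far)
  qed
  have pointwise: "(\<lambda>n. ennreal ((cmod (f t - step_function (g n) t))\<^sup>2)) \<longlonglongrightarrow> 0" for t
  proof -
    obtain N where "\<bar>t\<bar> < real N"
      using reals_Archimedean2 by blast
    then have "\<forall>\<^sub>F n in sequentially. cmod (f t - step_function (g n) t) \<le> inverse (real (Suc n))"
      by (intro eventually_sequentiallyI[of N] near) auto
    then have "(\<lambda>n. cmod (f t - step_function (g n) t)) \<longlonglongrightarrow> 0"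
      by (intro Lim_null_comparison[OF _ LIMSEQ_inverse_real_of_nat]) auto
    then have "(\<lambda>n. ennreal ((cmod (f t - step_function (g n) t))\<^sup>2)) \<longlonglongrightarrow> ennreal (0\<^sup>2)"
      by (intro tendsto_intros)
    then show ?thesis
      by simp
  qed
  have finite: "(\<integral>\<^sup>+ t. ennreal (1 + (cmod (f t))\<^sup>2) \<partial>?M) < \<infinity>"
  proof -
    have "(\<integral>\<^sup>+ t. ennreal (1 + (cmod (f t))\<^sup>2) \<partial>?M)
        = (\<integral>\<^sup>+ t. 1 \<partial>?M) + (\<integral>\<^sup>+ t. ennreal ((cmod (f t))\<^sup>2) \<partial>?M)"
      by (subst nn_integral_add[symmetric]) (auto simp: ennreal_plus)
    then show ?thesis
      using assms(3)
      by (simp add: spectral_dom_def emeasure_spectral_measure_UNIV[OF assms(1)])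
  qed
  have "(\<lambda>n. \<integral>\<^sup>+ t. ennreal ((cmod (f t - step_function (g n) t))\<^sup>2) \<partial>?M) \<longlonglongrightarrow> (\<integral>\<^sup>+ t. 0 \<partial>?M)"
    by (intro nn_integral_dominated_convergence[OF _ _ _ _ finite] AE_I2 ennreal_leI dominated
        pointwise) measurable
  then show ?thesis
    using proper by auto
qed

section \<open>The isometry for continuous functions\<close>

text \<open>
  A weighted form of the triangle inequality for squares: with a weight \<open>1 + e\<close> as close to 1
  as desired it passes through limits of integrals and replaces Minkowski's inequality.
\<close>

lemma cmod_square_perturbation:
  assumes "0 < e"
  shows "(cmod u)\<^sup>2 \<le> (1 + e) * (cmod v)\<^sup>2 + (1 + 1 / e) * (cmod (u - v))\<^sup>2"
proof -
  define a b where "a = cmod v" and "b = cmod (u - v)"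
  have "cmod u \<le> a + b"
    using norm_triangle_ineq[of v "u - v"] by (simp add: a_def b_def)
  then have "(cmod u)\<^sup>2 \<le> (a + b)\<^sup>2"
    by (intro power_mono) auto
  \<comment> \<open>Completing the square in the mixed term \<open>2 a b\<close>.\<close>
  also have "\<dots> = (1 + e) * a\<^sup>2 + (1 + 1 / e) * b\<^sup>2 - (e * a - b)\<^sup>2 / e"
    using assms by (simp add: power2_eq_square field_simps)
  also have "\<dots> \<le> (1 + e) * a\<^sup>2 + (1 + 1 / e) * b\<^sup>2"
    using assms by simp
  finally show ?thesis
    by (simp add: a_def b_def)
qed

lemma nn_integral_square_perturbation:
  fixes u v :: "'a \<Rightarrow> complex"
  assumes [measurable]: "u \<in> borel_measurable M" "v \<in> borel_measurable M" and "0 < e"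
  shows "(\<integral>\<^sup>+ t. ennreal ((cmod (u t))\<^sup>2) \<partial>M)
    \<le> ennreal (1 + e) * (\<integral>\<^sup>+ t. ennreal ((cmod (v t))\<^sup>2) \<partial>M)
      + ennreal (1 + 1 / e) * (\<integral>\<^sup>+ t. ennreal ((cmod (u t - v t))\<^sup>2) \<partial>M)"
proof -
  have "ennreal ((cmod (u t))\<^sup>2)
      \<le> ennreal (1 + e) * ennreal ((cmod (v t))\<^sup>2)
        + ennreal (1 + 1 / e) * ennreal ((cmod (u t - v t))\<^sup>2)" for t
    using ennreal_leI[OF cmod_square_perturbation[OF assms(3), of "u t" "v t"]] assms(3)
    by (simp add: ennreal_plus ennreal_mult)
  then have "(\<integral>\<^sup>+ t. ennreal ((cmod (u t))\<^sup>2) \<partial>M)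
      \<le> (\<integral>\<^sup>+ t. ennreal (1 + e) * ennreal ((cmod (v t))\<^sup>2)
        + ennreal (1 + 1 / e) * ennreal ((cmod (u t - v t))\<^sup>2) \<partial>M)"
    by (intro nn_integral_mono)
  also have "\<dots> = ennreal (1 + e) * (\<integral>\<^sup>+ t. ennreal ((cmod (v t))\<^sup>2) \<partial>M)
      + ennreal (1 + 1 / e) * (\<integral>\<^sup>+ t. ennreal ((cmod (u t - v t))\<^sup>2) \<partial>M)"
    by (simp add: nn_integral_add nn_integral_cmult)
  finally show ?thesis .
qed

lemma ennreal_le_of_scaled_le:
  assumes "\<And>e. 0 < e \<Longrightarrow> a \<le> ennreal (1 + e) * b" "b < \<infinity>"
  shows "a \<le> b"
proof -
  have lim: "(\<lambda>n. ennreal (1 + inverse (real (Suc n))) * b) \<longlonglongrightarrow> ennreal (1 + 0) * b"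
  proof (rule tendsto_mult_ennreal[OF _ tendsto_const])
    show "(\<lambda>n. ennreal (1 + inverse (real (Suc n)))) \<longlonglongrightarrow> ennreal (1 + 0)"
      by (intro tendsto_ennrealI tendsto_add tendsto_const LIMSEQ_inverse_real_of_nat)
  qed (use assms(2) in simp)
  have bound: "a \<le> ennreal (1 + inverse (real (Suc n))) * b" for n
    by (rule assms(1)) simp
  have "a \<le> ennreal (1 + 0) * b"
    by (intro LIMSEQ_le_const[OF lim] exI allI impI bound)
  then show ?thesis
    by simp
qed

lemma step_integral_distance:
  assumes "spectral_family E" "f \<in> borel_measurable borel" "proper_steps g" "proper_steps h"
  shows "ennreal ((norm (step_integral E g x - step_integral E h x))\<^sup>2)
    \<le> 2 * (\<integral>\<^sup>+ t. ennreal ((cmod (f t - step_function g t))\<^sup>2) \<partial>spectral_measure E x)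
      + 2 * (\<integral>\<^sup>+ t. ennreal ((cmod (f t - step_function h t))\<^sup>2) \<partial>spectral_measure E x)"
proof -
  have [measurable]: "f \<in> borel_measurable borel"
    by (rule assms(2))
  have flip: "cmod (step_function g t - step_function h t - (f t - step_function h t))
      = cmod (f t - step_function g t)" for t
    using norm_minus_commute[of "step_function g t" "f t"] by simp
  have "(\<lambda>t. step_function g t - step_function h t) \<in> borel_measurable (spectral_measure E x)"
    "(\<lambda>t. f t - step_function h t) \<in> borel_measurable (spectral_measure E x)"
    by measurable
  from nn_integral_square_perturbation[OF this, of 1] show ?thesis
    unfolding flip nn_integral_step_function_diff[OF assms(1,3,4)] by (simp add: add.commute)
qed

text \<open>
  Two sequences that approximate \<open>f\<close> in \<open>L\<^sup>2\<close> approximate each other, hence so do the vectors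
  that the isometry assigns to them.
\<close>

lemma has_spectral_integral_unique:
  assumes "spectral_family E" "f \<in> borel_measurable borel"
    and "has_spectral_integral E f x z" "has_spectral_integral E f x z'"
  shows "z = z'"
proof -
  let ?d = "\<lambda>g. \<integral>\<^sup>+ t. ennreal ((cmod (f t - step_function g t))\<^sup>2) \<partial>spectral_measure E x"
  from assms(3) obtain g where g: "\<And>n. proper_steps (g n)" "(\<lambda>n. ?d (g n)) \<longlonglongrightarrow> 0"
    "(\<lambda>n. step_integral E (g n) x) \<longlonglongrightarrow> z"
    unfolding has_spectral_integral_def by blast
  from assms(4) obtain h where h: "\<And>n. proper_steps (h n)" "(\<lambda>n. ?d (h n)) \<longlonglongrightarrow> 0"
    "(\<lambda>n. step_integral E (h n) x) \<longlonglongrightarrow> z'"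
    unfolding has_spectral_integral_def by blast
  have lim: "(\<lambda>n. 2 * ?d (g n) + 2 * ?d (h n)) \<longlonglongrightarrow> 2 * 0 + 2 * 0"
    by (intro tendsto_add ennreal_tendsto_cmult g h) auto
  have S: "(\<lambda>n. ennreal ((norm (step_integral E (g n) x - step_integral E (h n) x))\<^sup>2))
      \<longlonglongrightarrow> ennreal ((norm (z - z'))\<^sup>2)"
    by (intro tendsto_intros g h)
  have bound: "ennreal ((norm (step_integral E (g n) x - step_integral E (h n) x))\<^sup>2)
      \<le> 2 * ?d (g n) + 2 * ?d (h n)" for n
    by (rule step_integral_distance[OF assms(1,2) g(1) h(1)])
  have le: "ennreal ((norm (z - z'))\<^sup>2) \<le> 2 * 0 + 2 * 0"
    by (intro LIMSEQ_le[OF S lim] exI allI impI bound)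
  have "ennreal ((norm (z - z'))\<^sup>2) \<le> 0"
    using le by simp
  then have "(norm (z - z'))\<^sup>2 \<le> 0"
    by (simp only: le_zero_eq ennreal_eq_0_iff)
  then show ?thesis
    by simp
qed

text \<open>
  The step functions that approximate \<open>f\<close> form a Cauchy sequence in \<open>L\<^sup>2\<close>; the isometry carries it to a
  Cauchy sequence of vectors, which converges because the space is complete.
\<close>

lemma has_spectral_integral_exists:
  fixes E :: "real \<Rightarrow> 'h::complex_hilbert \<Rightarrow> 'h"
  assumes "spectral_family E" "continuous_on UNIV f" "x \<in> spectral_dom E f"
  shows "\<exists>z. has_spectral_integral E f x z"
proof -
  let ?d = "\<lambda>g. \<integral>\<^sup>+ t. ennreal ((cmod (f t - step_function g t))\<^sup>2) \<partial>spectral_measure E x"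
  have meas: "f \<in> borel_measurable borel"
    by (rule borel_measurable_continuous_onI[OF assms(2)])
  obtain g where proper: "\<And>n. proper_steps (g n)" and d: "(\<lambda>n. ?d (g n)) \<longlonglongrightarrow> 0"
    using L2_step_approximation[OF assms] by blast
  have "Cauchy (\<lambda>n. step_integral E (g n) x)"
  proof (rule metric_CauchyI)
    fix e :: real
    assume "0 < e"
    then have "\<forall>\<^sub>F n in sequentially. ?d (g n) < ennreal (e\<^sup>2 / 8)"
      by (intro order_tendstoD(2)[OF d]) simp
    then obtain N where N: "\<And>n. n \<ge> N \<Longrightarrow> ?d (g n) < ennreal (e\<^sup>2 / 8)"
      unfolding eventually_sequentially by blast
    have "dist (step_integral E (g m) x) (step_integral E (g n) x) < e" if "m \<ge> N" "n \<ge> N" for m n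
    proof -
      have "ennreal ((norm (step_integral E (g m) x - step_integral E (g n) x))\<^sup>2)
          \<le> 2 * ?d (g m) + 2 * ?d (g n)"
        by (rule step_integral_distance[OF assms(1) meas proper proper])
      also have "\<dots> \<le> 2 * ennreal (e\<^sup>2 / 8) + 2 * ennreal (e\<^sup>2 / 8)"
        using N[OF that(1)] N[OF that(2)] by (intro add_mono mult_left_mono) auto
      also have "\<dots> = ennreal (e\<^sup>2 / 2)"
        unfolding mult_2 by (simp flip: ennreal_plus)
      finally have "(norm (step_integral E (g m) x - step_integral E (g n) x))\<^sup>2 \<le> e\<^sup>2 / 2"
        by (subst (asm) ennreal_le_iff) auto
      also have "\<dots> < e\<^sup>2"
        using \<open>0 < e\<close> by simp
      finally show ?thesis
        using \<open>0 < e\<close> by (simp add: dist_norm power_less_imp_less_base)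
    qed
    then show "\<exists>N. \<forall>m\<ge>N. \<forall>n\<ge>N. dist (step_integral E (g m) x) (step_integral E (g n) x) < e"
      by blast
  qed
  then obtain z where "(\<lambda>n. step_integral E (g n) x) \<longlonglongrightarrow> z"
    using Cauchy_convergent convergent_def by blast
  then show ?thesis
    using proper d unfolding has_spectral_integral_def by blast
qed

text \<open>
  The isometry passes to the limit: the weighted triangle inequality compares \<open>f\<close> with its
  approximations in both directions, up to a factor \<open>1 + e\<close> that is finally sent to 1.
\<close>

lemma norm_has_spectral_integral:
  assumes "spectral_family E" "f \<in> borel_measurable borel" "x \<in> spectral_dom E f"
    and "has_spectral_integral E f x z"
  shows "ennreal ((norm z)\<^sup>2) = (\<integral>\<^sup>+ t. ennreal ((cmod (f t))\<^sup>2) \<partial>spectral_measure E x)"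
proof -
  let ?d = "\<lambda>g. \<integral>\<^sup>+ t. ennreal ((cmod (f t - step_function g t))\<^sup>2) \<partial>spectral_measure E x"
  let ?S = "\<lambda>g. ennreal ((norm (step_integral E g x))\<^sup>2)"
  let ?I = "\<integral>\<^sup>+ t. ennreal ((cmod (f t))\<^sup>2) \<partial>spectral_measure E x"
  have [measurable]: "f \<in> borel_measurable borel"
    by (rule assms(2))
  obtain g where proper: "\<And>n. proper_steps (g n)"
    and d: "(\<lambda>n. ?d (g n)) \<longlonglongrightarrow> 0" and z: "(\<lambda>n. step_integral E (g n) x) \<longlonglongrightarrow> z"
    using assms(4) unfolding has_spectral_integral_def by blast
  have S: "(\<lambda>n. ?S (g n)) \<longlonglongrightarrow> ennreal ((norm z)\<^sup>2)"
    by (intro tendsto_intros z)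
  have "?I < \<infinity>"
    using assms(3) by (simp add: spectral_dom_def)
  have "?I \<le> ennreal (1 + e) * ennreal ((norm z)\<^sup>2)" if "0 < e" for e
  proof -
    have lim: "(\<lambda>n. ennreal (1 + e) * ?S (g n) + ennreal (1 + 1 / e) * ?d (g n))
        \<longlonglongrightarrow> ennreal (1 + e) * ennreal ((norm z)\<^sup>2) + ennreal (1 + 1 / e) * 0"
      by (intro tendsto_add ennreal_tendsto_cmult S d) auto
    have bound: "?I \<le> ennreal (1 + e) * ?S (g n) + ennreal (1 + 1 / e) * ?d (g n)" for n
    proof -
      have "f \<in> borel_measurable (spectral_measure E x)"
        "step_function (g n) \<in> borel_measurable (spectral_measure E x)"
        by measurable
      from nn_integral_square_perturbation[OF this that] show ?thesis
        unfolding nn_integral_step_function[OF assms(1) proper] .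
    qed
    have "?I \<le> ennreal (1 + e) * ennreal ((norm z)\<^sup>2) + ennreal (1 + 1 / e) * 0"
      by (intro LIMSEQ_le_const[OF lim] exI allI impI bound)
    then show ?thesis
      by simp
  qed
  then have "?I \<le> ennreal ((norm z)\<^sup>2)"
    by (rule ennreal_le_of_scaled_le) auto
  have "ennreal ((norm z)\<^sup>2) \<le> ennreal (1 + e) * ?I" if "0 < e" for e
  proof -
    have lim: "(\<lambda>n. ennreal (1 + e) * ?I + ennreal (1 + 1 / e) * ?d (g n))
        \<longlonglongrightarrow> ennreal (1 + e) * ?I + ennreal (1 + 1 / e) * 0"
      by (intro tendsto_add tendsto_const ennreal_tendsto_cmult d) auto
    have bound: "?S (g n) \<le> ennreal (1 + e) * ?I + ennreal (1 + 1 / e) * ?d (g n)" for n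
    proof -
      have flip: "cmod (step_function (g n) t - f t) = cmod (f t - step_function (g n) t)" for t
        by (rule norm_minus_commute)
      have "step_function (g n) \<in> borel_measurable (spectral_measure E x)"
        "f \<in> borel_measurable (spectral_measure E x)"
        by measurable
      from nn_integral_square_perturbation[OF this that] show ?thesis
        unfolding flip nn_integral_step_function[OF assms(1) proper] .
    qed
    have "ennreal ((norm z)\<^sup>2) \<le> ennreal (1 + e) * ?I + ennreal (1 + 1 / e) * 0"
      by (intro LIMSEQ_le[OF S lim] exI allI impI bound)
    then show ?thesis
      by simp
  qed
  then have "ennreal ((norm z)\<^sup>2) \<le> ?I"
    using \<open>?I < \<infinity>\<close> by (rule ennreal_le_of_scaled_le)
  with \<open>?I \<le> ennreal ((norm z)\<^sup>2)\<close> show ?thesis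
    by simp
qed

theorem norm_spectral_op:
  fixes E :: "real \<Rightarrow> 'h::complex_hilbert \<Rightarrow> 'h"
  assumes "spectral_family E" "continuous_on UNIV f" "x \<in> spectral_dom E f"
  shows "ennreal ((norm (spectral_op E f x))\<^sup>2)
    = (\<integral>\<^sup>+ t. ennreal ((cmod (f t))\<^sup>2) \<partial>spectral_measure E x)"
proof -
  have meas: "f \<in> borel_measurable borel"
    by (rule borel_measurable_continuous_onI[OF assms(2)])
  obtain z where z: "has_spectral_integral E f x z"
    using has_spectral_integral_exists[OF assms] by blast
  then have "spectral_op E f x = z"
    unfolding spectral_op_def
    using has_spectral_integral_unique[OF assms(1) meas] by (intro the_equality) blast+
  then show ?thesis
    using norm_has_spectral_integral[OF assms(1) meas assms(3) z] by simp
qed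

section \<open>The upper bound\<close>

lemma concave_supporting_line:
  fixes F :: "real \<Rightarrow> real"
  assumes "concave_on {0..} F" "0 < u"
  shows "\<exists>k. \<forall>v\<ge>0. F v \<le> F u + k * (v - u)"
proof -
  have "convex_on {0..} (\<lambda>v. - F v)"
    using assms(1) by (simp add: concave_on_def)
  moreover have "u \<in> interior {0..}"
    using assms(2) by simp
  ultimately have "\<exists>k. \<forall>v\<in>{0..}. - F v \<ge> - F u + k * (v - u)"
    using convex_le_Inf_differential by blast
  then obtain k where k: "\<And>v. 0 \<le> v \<Longrightarrow> - F v \<ge> - F u + k * (v - u)"
    by auto
  have "F v \<le> F u + (- k) * (v - u)" if "0 \<le> v" for v
    using k[OF that] by (simp add: algebra_simps)
  then show ?thesis
    by blast
qed

lemma nn_integral_square_affine_bound: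
  fixes \<phi> \<psi> :: "real \<Rightarrow> complex"
  assumes "spectral_family E" "\<psi> \<in> borel_measurable borel" "0 \<le> a" "0 \<le> k"
    and "\<And>t. (cmod (\<phi> t))\<^sup>2 \<le> a + k * (cmod (\<psi> t))\<^sup>2"
  shows "(\<integral>\<^sup>+ t. ennreal ((cmod (\<phi> t))\<^sup>2) \<partial>spectral_measure E x)
    \<le> ennreal (a * (norm x)\<^sup>2)
      + ennreal k * (\<integral>\<^sup>+ t. ennreal ((cmod (\<psi> t))\<^sup>2) \<partial>spectral_measure E x)"
proof -
  have [measurable]: "\<psi> \<in> borel_measurable borel"
    by (rule assms(2))
  have "ennreal ((cmod (\<phi> t))\<^sup>2) \<le> ennreal a + ennreal k * ennreal ((cmod (\<psi> t))\<^sup>2)" for t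
    using ennreal_leI[OF assms(5)[of t]] assms(3,4) by (simp add: ennreal_plus ennreal_mult)
  then have "(\<integral>\<^sup>+ t. ennreal ((cmod (\<phi> t))\<^sup>2) \<partial>spectral_measure E x)
      \<le> (\<integral>\<^sup>+ t. ennreal a + ennreal k * ennreal ((cmod (\<psi> t))\<^sup>2) \<partial>spectral_measure E x)"
    by (intro nn_integral_mono)
  also have "\<dots> = ennreal (a * (norm x)\<^sup>2)
      + ennreal k * (\<integral>\<^sup>+ t. ennreal ((cmod (\<psi> t))\<^sup>2) \<partial>spectral_measure E x)"
    using assms(3)
    by (simp add: nn_integral_add nn_integral_cmult emeasure_spectral_measure_UNIV[OF assms(1)]
        ennreal_mult)
  finally show ?thesis .
qed

text \<open>
  The intercept \<open>a\<close> and the slope \<open>k\<close> of the supporting line at \<open>u = 1/\<delta>\<^sup>2\<close> are both nonnegative, so the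
  constraints \<open>\<parallel>x\<parallel> \<le> \<delta>\<close> and \<open>\<parallel>\<psi>(A) x\<parallel> \<le> 1\<close> can be inserted into the integrated inequality.
\<close>

lemma norm_spectral_op_le:
  fixes E :: "real \<Rightarrow> 'h::complex_hilbert \<Rightarrow> 'h"
  assumes "spectral_family E" "continuous_on UNIV \<phi>" "continuous_on UNIV \<psi>"
    and "strict_mono_on {0..} F" "concave_on {0..} F" "F 0 = 0"
    and "\<And>t. (cmod (\<phi> t))\<^sup>2 = F ((cmod (\<psi> t))\<^sup>2)"
    and "0 < \<delta>" "x \<in> spectral_class E \<psi>" "norm x \<le> \<delta>"
  shows "norm (spectral_op E \<phi> x) \<le> \<delta> * sqrt (F (1 / \<delta>\<^sup>2))"
proof -
  define u where "u = 1 / \<delta>\<^sup>2"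
  have "0 < u"
    using assms(8) by (simp add: u_def)
  obtain k where k: "\<And>v. 0 \<le> v \<Longrightarrow> F v \<le> F u + k * (v - u)"
    using concave_supporting_line[OF assms(5) \<open>0 < u\<close>] by blast
  define a where "a = F u - k * u"
  have "0 \<le> a"
    using k[of 0] assms(6) by (simp add: a_def)
  \<comment> \<open>The slope is positive since \<open>F\<close> still grows to the right of the point of contact.\<close>
  have "F u < F (2 * u)"
    using \<open>0 < u\<close> by (intro strict_mono_onD[OF assms(4)]) auto
  then have "0 < k * u"
    using k[of "2 * u"] \<open>0 < u\<close> by (simp add: algebra_simps)
  then have "0 \<le> k"
    using \<open>0 < u\<close> by (simp add: zero_less_mult_iff)
  have x: "x \<in> spectral_dom E \<psi>" and "norm (spectral_op E \<psi> x) \<le> 1"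
    using assms(9) by (simp_all add: spectral_class_def)
  let ?I = "\<lambda>f. \<integral>\<^sup>+ t. ennreal ((cmod (f t))\<^sup>2) \<partial>spectral_measure E x"
  have \<psi>: "?I \<psi> = ennreal ((norm (spectral_op E \<psi> x))\<^sup>2)"
    by (rule norm_spectral_op[OF assms(1,3) x, symmetric])
  have bound: "(cmod (\<phi> t))\<^sup>2 \<le> a + k * (cmod (\<psi> t))\<^sup>2" for t
    using k[of "(cmod (\<psi> t))\<^sup>2"] assms(7)[of t] by (simp add: a_def algebra_simps)
  have "?I \<phi> \<le> ennreal (a * (norm x)\<^sup>2) + ennreal k * ennreal ((norm (spectral_op E \<psi> x))\<^sup>2)"
    using nn_integral_square_affine_bound[OF assms(1) borel_measurable_continuous_onI[OF assms(3)]
        \<open>0 \<le> a\<close> \<open>0 \<le> k\<close> bound, of x] unfolding \<psi> .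
  also have "\<dots> = ennreal (a * (norm x)\<^sup>2 + k * (norm (spectral_op E \<psi> x))\<^sup>2)"
    using \<open>0 \<le> a\<close> \<open>0 \<le> k\<close> by (simp add: ennreal_plus ennreal_mult)
  also have "\<dots> \<le> ennreal (a * \<delta>\<^sup>2 + k * 1)"
    using \<open>0 \<le> a\<close> \<open>0 \<le> k\<close> assms(10) \<open>norm (spectral_op E \<psi> x) \<le> 1\<close>
    by (intro ennreal_leI add_mono mult_left_mono power_mono power_le_one) auto
  also have "a * \<delta>\<^sup>2 + k * 1 = \<delta>\<^sup>2 * F u"
    using assms(8) by (simp add: a_def u_def field_simps)
  finally have I: "?I \<phi> \<le> ennreal (\<delta>\<^sup>2 * F u)" .
  have "x \<in> spectral_dom E \<phi>"
    using le_less_trans[OF I ennreal_less_top] by (simp add: spectral_dom_def)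
  then have "ennreal ((norm (spectral_op E \<phi> x))\<^sup>2) \<le> ennreal (\<delta>\<^sup>2 * F u)"
    using I norm_spectral_op[OF assms(1,2)] by simp
  moreover have "0 \<le> \<delta>\<^sup>2 * F u"
    using strict_mono_onD[OF assms(4), of 0 u] \<open>0 < u\<close> assms(6) by simp
  ultimately have "(norm (spectral_op E \<phi> x))\<^sup>2 \<le> \<delta>\<^sup>2 * F u"
    by (simp add: ennreal_le_iff)
  then have "norm (spectral_op E \<phi> x) \<le> sqrt (\<delta>\<^sup>2 * F u)"
    by (rule real_le_rsqrt)
  then show ?thesis
    using assms(8) by (simp add: real_sqrt_mult u_def)
qed

section \<open>Spectrally localised vectors and the lower bound\<close>

text \<open>
  The interval \<open>[s, t)\<close> already carries the mass \<open>\<parallel>E\<^sub>t y\<parallel>\<^sup>2 - \<parallel>E\<^sub>s y\<parallel>\<^sup>2 = \<parallel>y\<parallel>\<^sup>2\<close>, which is the total mass.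
\<close>

lemma AE_spectral_measure_localised:
  assumes "spectral_family E" "s \<le> t" "E s y = 0" "E t y = y"
  shows "AE r in spectral_measure E y. r \<in> {s..<t}"
proof (rule AE_I)
  let ?M = "spectral_measure E y"
  have Ico: "emeasure ?M {s..<t} = emeasure ?M UNIV"
    by (simp add: emeasure_spectral_measure_Ico[OF assms(1,2)]
        emeasure_spectral_measure_UNIV[OF assms(1)] assms(3,4))
  have "emeasure ?M (UNIV - {s..<t}) = emeasure ?M UNIV - emeasure ?M {s..<t}"
    by (intro emeasure_Diff) (simp_all add: emeasure_spectral_measure_UNIV[OF assms(1)] Ico)
  then show "emeasure ?M (UNIV - {s..<t}) = 0"
    by (simp add: Ico emeasure_spectral_measure_UNIV[OF assms(1)])
  show "UNIV - {s..<t} \<in> sets ?M"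
    by simp
qed auto

text \<open>
  On a vector whose spectral measure lives on \<open>[s, t)\<close>, the operator \<open>f(A)\<close> sees only the values of \<open>f\<close>
  there, so bounds on \<open>\<bar>f\<bar>\<close> become bounds on the stretching factor.
\<close>

lemma norm_spectral_op_localised:
  fixes E :: "real \<Rightarrow> 'h::complex_hilbert \<Rightarrow> 'h"
  assumes "spectral_family E" "continuous_on UNIV f" "s \<le> t" "E s y = 0" "E t y = y"
    and "\<And>r. r \<in> {s..<t} \<Longrightarrow> m \<le> cmod (f r)" "\<And>r. r \<in> {s..<t} \<Longrightarrow> cmod (f r) \<le> K"
    and "0 \<le> m" "0 \<le> K"
  shows "y \<in> spectral_dom E f"
    and "m * norm y \<le> norm (spectral_op E f y)" "norm (spectral_op E f y) \<le> K * norm y"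
proof -
  let ?M = "spectral_measure E y"
  let ?I = "\<integral>\<^sup>+ r. ennreal ((cmod (f r))\<^sup>2) \<partial>?M"
  have const: "(\<integral>\<^sup>+ r. ennreal (c\<^sup>2) \<partial>?M) = ennreal ((c * norm y)\<^sup>2)" for c :: real
    by (simp add: emeasure_spectral_measure_UNIV[OF assms(1)] ennreal_mult power_mult_distrib)
  note localised = AE_spectral_measure_localised[OF assms(1,3-5)]
  have "AE r in ?M. ennreal (m\<^sup>2) \<le> ennreal ((cmod (f r))\<^sup>2)"
    using localised by (rule AE_mp) (intro AE_I2 impI ennreal_leI power_mono assms)
  then have lower: "ennreal ((m * norm y)\<^sup>2) \<le> ?I"
    unfolding const[symmetric] by (rule nn_integral_mono_AE)
  have "AE r in ?M. ennreal ((cmod (f r))\<^sup>2) \<le> ennreal (K\<^sup>2)"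
    using localised by (rule AE_mp) (intro AE_I2 impI ennreal_leI power_mono assms norm_ge_zero)
  then have upper: "?I \<le> ennreal ((K * norm y)\<^sup>2)"
    unfolding const[symmetric] by (rule nn_integral_mono_AE)
  show dom: "y \<in> spectral_dom E f"
    using le_less_trans[OF upper ennreal_less_top] by (simp add: spectral_dom_def)
  have "(m * norm y)\<^sup>2 \<le> (norm (spectral_op E f y))\<^sup>2"
    "(norm (spectral_op E f y))\<^sup>2 \<le> (K * norm y)\<^sup>2"
    using lower upper unfolding norm_spectral_op[OF assms(1,2) dom, symmetric]
    by (simp_all add: ennreal_le_iff del: power_mult_distrib)
  then show "m * norm y \<le> norm (spectral_op E f y)" "norm (spectral_op E f y) \<le> K * norm y"
    using assms(8,9) by (auto intro: power2_le_imp_le)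
qed

text \<open>
  The conditions \<open>E\<^sub>s y = 0\<close> and \<open>E\<^sub>t y = y\<close> describe the range of \<open>E\<^sub>t - E\<^sub>s\<close>.
\<close>

lemma localised_unit_vector:
  assumes "spectral_family E" "s \<le> t" "E t x - E s x \<noteq> 0"
  shows "\<exists>y. norm y = 1 \<and> E s y = 0 \<and> E t y = y"
proof -
  define z where "z = E t x - E s x"
  have comp: "E u (E v x) = E (min u v) x" for u v
    using assms(1) by (simp add: spectral_family_def)
  have z: "E s z = 0" "E t z = z"
    using assms(2) by (simp_all add: z_def spectral_family_diff[OF assms(1)] comp)
  have scale: "E r (c *\<^sub>R z) = c *\<^sub>R E r z" for r c
    unfolding scaleC_of_real[symmetric] by (rule spectral_family_scaleC[OF assms(1)])
  show ?thesis
    using assms(3) by (intro exI[of _ "inverse (norm z) *\<^sub>R z"]) (simp add: scale z z_def[symmetric])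
qed

lemma zero_in_spectral_dom:
  assumes "spectral_family E"
  shows "0 \<in> spectral_dom E f"
proof -
  have "AE t in spectral_measure E 0. (\<lambda>_. False) t"
    by (rule AE_I[where N = UNIV]) (simp_all add: emeasure_spectral_measure_UNIV[OF assms])
  then have "(\<integral>\<^sup>+ t. ennreal ((cmod (f t))\<^sup>2) \<partial>spectral_measure E 0)
      = (\<integral>\<^sup>+ t. 0 \<partial>spectral_measure E 0)"
    by (intro nn_integral_cong_AE) auto
  then show ?thesis
    by (simp add: spectral_dom_def)
qed

text \<open>
  The point \<open>\<tau>\<close> of the lower bound may be \<open>0\<close>, where the strict monotonicity on \<open>(0, \<infinity>)\<close> has to be
  extended by continuity.
\<close>

lemma mono_on_closed_half_line:
  fixes h :: "real \<Rightarrow> real"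
  assumes "continuous_on UNIV h" "strict_mono_on {0<..} h"
  shows "mono_on {0..} h"
proof (rule mono_onI)
  fix a b :: real
  assume "a \<in> {0..}" "b \<in> {0..}" "a \<le> b"
  then consider "a = b" | "0 < a" "a < b" | "a = 0" "0 < b"
    by fastforce
  then show "h a \<le> h b"
  proof cases
    case 1
    then show ?thesis by simp
  next
    case 2
    then show ?thesis
      using strict_mono_onD[OF assms(2), of a b] by simp
  next
    case 3
    have "(h \<longlongrightarrow> h 0) (at_right 0)"
      using assms(1) by (simp add: continuous_on_eq_continuous_at isCont_def filterlim_at_split)
    moreover have "\<forall>\<^sub>F c in at_right 0. h c \<le> h b"
      using eventually_at_right_real[OF 3(2)]
      by eventually_elim (use strict_mono_onD[OF assms(2)] 3 in \<open>auto intro: less_imp_le\<close>)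
    ultimately show ?thesis
      unfolding 3(1) by (rule tendsto_upperbound) simp
  qed
qed

text \<open>
  The witness is a vector in the range of \<open>E\<^sub>t - E\<^sub>s\<close> of length \<open>1 / \<bar>\<psi>(t)\<bar>\<close>, the largest length for which the
  crude bound \<open>\<bar>\<psi>\<bar> \<le> \<bar>\<psi>(t)\<bar>\<close> on \<open>[s, t)\<close> still guarantees \<open>\<parallel>\<psi>(A) y\<parallel> \<le> 1\<close>.
\<close>

lemma modulus_of_continuity_ge:
  fixes E :: "real \<Rightarrow> 'h::complex_hilbert \<Rightarrow> 'h"
  assumes "spectral_family E" "continuous_on UNIV \<phi>" "continuous_on UNIV \<psi>"
    and "mono_on {0..} (\<lambda>t. cmod (\<phi> t))" "mono_on {0..} (\<lambda>t. cmod (\<psi> t))"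
    and "0 \<le> s" "s < t" "0 < cmod (\<psi> s)"
    and "E t x - E s x \<noteq> 0"
  shows "ereal (cmod (\<phi> s) / cmod (\<psi> t))
    \<le> modulus_of_continuity (spectral_op E \<phi>) (spectral_class E \<psi>) (1 / cmod (\<psi> s))"
proof -
  let ?q = "cmod (\<psi> t)"
  have mono: "cmod (\<psi> r) \<le> ?q" "cmod (\<phi> s) \<le> cmod (\<phi> r)" "cmod (\<phi> r) \<le> cmod (\<phi> t)"
    if "r \<in> {s..<t}" for r
    using that assms(6) by (auto intro: mono_onD[OF assms(4)] mono_onD[OF assms(5)])
  have "cmod (\<psi> s) \<le> ?q"
    using assms(7) by (intro mono) auto
  then have "0 < ?q"
    using assms(8) by linarith
  obtain e where e: "norm e = 1" "E s e = 0" "E t e = e"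
    using localised_unit_vector[OF assms(1) less_imp_le[OF assms(7)] assms(9)] by blast
  define y where "y = inverse ?q *\<^sub>R e"
  have scale: "E r y = inverse ?q *\<^sub>R E r e" for r
    unfolding y_def scaleC_of_real[symmetric] by (rule spectral_family_scaleC[OF assms(1)])
  have y: "E s y = 0" "E t y = y"
    using e scale by (simp_all add: y_def)
  have norm_y: "norm y = 1 / ?q"
    using e(1) \<open>0 < ?q\<close> by (simp add: y_def inverse_eq_divide)
  have "y \<in> spectral_dom E \<psi>" "norm (spectral_op E \<psi> y) \<le> ?q * norm y"
    using norm_spectral_op_localised[OF assms(1,3) less_imp_le[OF assms(7)] y, of 0 ?q] mono
    by auto
  then have "y \<in> spectral_class E \<psi>"
    using norm_y \<open>0 < ?q\<close> by (simp add: spectral_class_def)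
  moreover have "norm y \<le> 1 / cmod (\<psi> s)"
    using norm_y \<open>cmod (\<psi> s) \<le> ?q\<close> assms(8) by (simp add: frac_le)
  ultimately have "ereal (norm (spectral_op E \<phi> y))
      \<le> modulus_of_continuity (spectral_op E \<phi>) (spectral_class E \<psi>) (1 / cmod (\<psi> s))"
    unfolding modulus_of_continuity_def by (intro SUP_upper) simp
  moreover have "cmod (\<phi> s) * norm y \<le> norm (spectral_op E \<phi> y)"
    using mono
    by (intro norm_spectral_op_localised(2)[OF assms(1,2) less_imp_le[OF assms(7)] y, of _ "cmod (\<phi> t)"])
      auto
  ultimately show ?thesis
    using norm_y by (auto intro: order_trans[rotated])
qed

theorem theorem4:
  fixes D :: "'h::complex_hilbert set"
    and A :: "'h \<Rightarrow> 'h"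
    and E :: "real \<Rightarrow> 'h \<Rightarrow> 'h"
    and \<phi> \<psi> :: "real \<Rightarrow> complex"
    and F :: "real \<Rightarrow> real"
  assumes "self_adjoint_operator D A"
    and "unbounded_operator D A"
    and "partition_of_unity D A E"
    and "continuous_on UNIV \<phi>"
    and "continuous_on UNIV \<psi>"
    and "\<And>t. cmod (\<phi> (- t)) = cmod (\<phi> t)"
    and "\<And>t. cmod (\<psi> (- t)) = cmod (\<psi> t)"
    and "strict_mono_on {0<..} (\<lambda>t. cmod (\<phi> t))"
    and "strict_mono_on {0<..} (\<lambda>t. cmod (\<psi> t))"
    and "strict_mono_on {0..} F"
    and "concave_on {0..} F"
    and "F 0 = 0"
    and "\<And>t. (cmod (\<phi> t))\<^sup>2 = F ((cmod (\<psi> t))\<^sup>2)"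
  shows "(\<forall>\<delta>>0. modulus_of_continuity (spectral_op E \<phi>) (spectral_class E \<psi>) \<delta>
              \<le> ereal (\<delta> * sqrt (F (1 / \<delta>\<^sup>2))))
       \<and> ((\<forall>s t :: ereal. 0 \<le> s \<and> s < t \<and> t \<le> \<infinity> \<longrightarrow>
              (\<lambda>x. spectral_extend E t x - spectral_extend E s x) ` spectral_dom E \<psi> \<noteq> {0}) \<longrightarrow>
          (\<forall>\<delta>>0. 1 / \<delta>\<^sup>2 \<in> range (\<lambda>t. (cmod (\<psi> t))\<^sup>2) \<longrightarrow>
              modulus_of_continuity (spectral_op E \<phi>) (spectral_class E \<psi>) \<delta>
              = ereal (\<delta> * sqrt (F (1 / \<delta>\<^sup>2)))))"
proof (intro conjI allI impI)
  have E: "spectral_family E"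
    using assms(3) by (simp add: partition_of_unity_def)
  {
    fix \<delta> :: real
    assume "0 < \<delta>"
    then show "modulus_of_continuity (spectral_op E \<phi>) (spectral_class E \<psi>) \<delta>
        \<le> ereal (\<delta> * sqrt (F (1 / \<delta>\<^sup>2)))"
      unfolding modulus_of_continuity_def
      using norm_spectral_op_le[OF E assms(4,5,10-13)] by (intro SUP_least) auto
  }
  note upper = this
  fix \<delta> :: real
  assume nontrivial: "\<forall>s t :: ereal. 0 \<le> s \<and> s < t \<and> t \<le> \<infinity> \<longrightarrow>
      (\<lambda>x. spectral_extend E t x - spectral_extend E s x) ` spectral_dom E \<psi> \<noteq> {0}"
    and "0 < \<delta>" and "1 / \<delta>\<^sup>2 \<in> range (\<lambda>t. (cmod (\<psi> t))\<^sup>2)"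
  then obtain t where t: "1 / \<delta>\<^sup>2 = (cmod (\<psi> t))\<^sup>2"
    by blast
  \<comment> \<open>As \<open>\<bar>\<psi>\<bar>\<close> is even, the level \<open>1/\<delta>\<close> is attained on the half-line where \<open>\<bar>\<psi>\<bar>\<close> increases.\<close>
  define \<tau> where "\<tau> = \<bar>t\<bar>"
  have "0 \<le> \<tau>"
    by (simp add: \<tau>_def)
  have "cmod (\<psi> \<tau>) = cmod (\<psi> t)"
    using assms(7)[of t] by (simp add: \<tau>_def abs_if)
  then have "(cmod (\<psi> \<tau>))\<^sup>2 = (1 / \<delta>)\<^sup>2"
    using t by (simp add: power_divide)
  then have \<psi>\<tau>: "cmod (\<psi> \<tau>) = 1 / \<delta>"
    using \<open>0 < \<delta>\<close> by (simp add: power2_eq_iff_nonneg)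
  have \<phi>\<tau>: "cmod (\<phi> \<tau>) = sqrt (F (1 / \<delta>\<^sup>2))"
    using assms(13)[of \<tau>] \<psi>\<tau> by (simp add: real_sqrt_unique power_divide)
  have mono: "mono_on {0..} (\<lambda>t. cmod (\<phi> t))" "mono_on {0..} (\<lambda>t. cmod (\<psi> t))"
    using assms(4,5,8,9) by (intro mono_on_closed_half_line continuous_intros; simp)+
  have lower: "ereal (cmod (\<phi> \<tau>) / cmod (\<psi> r))
      \<le> modulus_of_continuity (spectral_op E \<phi>) (spectral_class E \<psi>) \<delta>" if "\<tau> < r" for r
  proof -
    have image: "(\<lambda>x. E r x - E \<tau> x) ` spectral_dom E \<psi> \<noteq> {0}"
      using nontrivial[rule_format, of "ereal \<tau>" "ereal r"] that \<open>0 \<le> \<tau>\<close>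
      by (simp add: spectral_extend_def)
    have "\<exists>x. E r x - E \<tau> x \<noteq> 0"
    proof (rule ccontr)
      assume "\<nexists>x. E r x - E \<tau> x \<noteq> 0"
      then have "(\<lambda>x. E r x - E \<tau> x) ` spectral_dom E \<psi> = (\<lambda>x. 0) ` spectral_dom E \<psi>"
        by (intro image_cong refl) blast
      also have "\<dots> = {0}"
        by (rule image_constant[OF zero_in_spectral_dom[OF E]])
      finally show False
        using image by contradiction
    qed
    then obtain x where "E r x - E \<tau> x \<noteq> 0" ..
    from modulus_of_continuity_ge[OF E assms(4,5) mono \<open>0 \<le> \<tau>\<close> that _ this] show ?thesis
      using \<psi>\<tau> \<open>0 < \<delta>\<close> by simp
  qed
  have "((\<lambda>r. ereal (cmod (\<phi> \<tau>) / cmod (\<psi> r))) \<longlongrightarrow> ereal (cmod (\<phi> \<tau>) / cmod (\<psi> \<tau>))) (at_right \<tau>)"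
  proof (intro tendsto_intros)
    show "(\<psi> \<longlongrightarrow> \<psi> \<tau>) (at_right \<tau>)"
      using assms(5) by (simp add: continuous_on_eq_continuous_at isCont_def filterlim_at_split)
    show "cmod (\<psi> \<tau>) \<noteq> 0"
      using \<psi>\<tau> \<open>0 < \<delta>\<close> by simp
  qed
  moreover have "\<forall>\<^sub>F r in at_right \<tau>. ereal (cmod (\<phi> \<tau>) / cmod (\<psi> r))
      \<le> modulus_of_continuity (spectral_op E \<phi>) (spectral_class E \<psi>) \<delta>"
    using lower by (auto simp: eventually_at_filter)
  ultimately have "ereal (cmod (\<phi> \<tau>) / cmod (\<psi> \<tau>))
      \<le> modulus_of_continuity (spectral_op E \<phi>) (spectral_class E \<psi>) \<delta>"
    by (rule tendsto_upperbound) simp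
  then have "ereal (\<delta> * sqrt (F (1 / \<delta>\<^sup>2)))
      \<le> modulus_of_continuity (spectral_op E \<phi>) (spectral_class E \<psi>) \<delta>"
    unfolding \<phi>\<tau> \<psi>\<tau> by (simp add: mult.commute)
  with upper[OF \<open>0 < \<delta>\<close>] show "modulus_of_continuity (spectral_op E \<phi>) (spectral_class E \<psi>) \<delta>
      = ereal (\<delta> * sqrt (F (1 / \<delta>\<^sup>2)))"
    by (rule antisym)
qed

end
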